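(* For each $n\ge 1$ let $(X_{ij})_{1\le i,j\le n}$ be i.i.d. standard Gaussian random variables, let $S(\pi)=\sum_{i=1}^n X_{i\pi(i)}$ for every permutation $\pi$ of $\{1,\dots,n\}$, and let $\pi^*$ be the greedy random permutation of $\{1,\dots,n\}$ associated with $(X_{ij})$. Then \[ \lim_{n\to\infty}\frac{\mathbb{E}\,S(\pi^* )}{n\sqrt{2\log n}}=1 . \]
   Context: Here $\log$ is the natural logarithm. Write $[i]=\{1,2,\dots,i\}$. The greedy random permutation $\pi^*$ is defined recursively by \[ \pi^*(1)=\arg\max_{j\in[n]}X_{1j},\qquad \pi^*(i)=\arg\max_{j\in[n]\setminus\pi^*([i-1])}X_{ij}\quad (i=2,\dots,n). \] The maximizers are almost surely unique. Accordingly, $S(\pi^* )=\sum_{i=1}^n X_{i\pi^*(i)}$. The dependence of $X_{ij}$, $S$ and $\pi^*$ on $n$ is suppressed from the notation. *)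

theory Defs
  imports "HOL-Probability.Probability" "HOL-Combinatorics.Permutations"
begin

definition assignment_sum :: "nat \<Rightarrow> (nat \<Rightarrow> nat \<Rightarrow> real) \<Rightarrow> (nat \<Rightarrow> nat) \<Rightarrow> real" where
  "assignment_sum n x \<pi> = (\<Sum>i\<in>{1..n}. x i (\<pi> i))"

text \<open>
  The greedy permutation of a fixed matrix. Ties are broken by the choice operator inside
  \<^const>\<open>arg_max_on\<close>, so the result is a function of the matrix alone. Outside of
  \<open>{1..n}\<close> it is the identity, as required by \<^const>\<open>permutes\<close>.
\<close>
function greedy_perm :: "nat \<Rightarrow> (nat \<Rightarrow> nat \<Rightarrow> real) \<Rightarrow> nat \<Rightarrow> nat" where
  "greedy_perm n x i =
     (if i \<in> {1..n} then arg_max_on (x i) ({1..n} - greedy_perm n x ` {1..<i}) else i)"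
  by auto
termination
  by (relation "Wellfounded.measure (\<lambda>(n, x, i). i)") auto

declare greedy_perm.simps [simp del]

lemma arg_max_on_finite:
  fixes f :: "nat \<Rightarrow> real"
  assumes "finite A" "A \<noteq> {}"
  shows "arg_max_on f A \<in> A" and "\<And>a. a \<in> A \<Longrightarrow> f a \<le> f (arg_max_on f A)"
proof -
  have "Max (f ` A) \<in> f ` A"
    using assms by simp
  then obtain m where m: "m \<in> A" "Max (f ` A) = f m"
    by auto
  have "is_arg_max f (\<lambda>a. a \<in> A) m"
    unfolding is_arg_max_def
    using m assms by (metis Max_ge finite_imageI image_eqI linorder_not_less)
  then have *: "is_arg_max f (\<lambda>a. a \<in> A) (arg_max_on f A)"
    unfolding arg_max_on_def arg_max_def by (rule someI)
  then show "arg_max_on f A \<in> A" and "\<And>a. a \<in> A \<Longrightarrow> f a \<le> f (arg_max_on f A)"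
    by (auto simp: is_arg_max_def not_less)
qed

lemma greedy_perm_remaining:
  assumes "i \<in> {1..n}"
  shows "{1..n} - greedy_perm n x ` {1..<i} \<noteq> {}"
proof
  assume "{1..n} - greedy_perm n x ` {1..<i} = {}"
  then have "card {1..n} \<le> card (greedy_perm n x ` {1..<i})"
    by (intro card_mono) auto
  also have "\<dots> \<le> card {1..<i}"
    by (rule card_image_le) simp
  finally have "n \<le> i - 1"
    by simp
  moreover have "1 \<le> i" "i \<le> n"
    using assms by auto
  ultimately show False
    by linarith
qed

lemma greedy_perm_in:
  assumes "i \<in> {1..n}"
  shows "greedy_perm n x i \<in> {1..n} - greedy_perm n x ` {1..<i}"
  using arg_max_on_finite(1)[OF _ greedy_perm_remaining[OF assms, of x], of "x i"] assms
  by (subst greedy_perm.simps) simp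

lemma greedy_perm_permutes: "greedy_perm n x permutes {1..n}"
proof (rule bij_imp_permutes)
  have neq: "greedy_perm n x i \<noteq> greedy_perm n x j"
    if "i \<in> {1..n}" "j \<in> {1..n}" "i < j" for i j
    using greedy_perm_in[OF that(2), of x] that
    by (metis DiffD2 atLeastAtMost_iff atLeastLessThan_iff image_eqI)
  have inj: "inj_on (greedy_perm n x) {1..n}"
    by (rule inj_onI) (metis neq linorder_neqE_nat)
  moreover have "greedy_perm n x ` {1..n} \<subseteq> {1..n}"
    using greedy_perm_in[of _ n x] by auto
  ultimately show "bij_betw (greedy_perm n x) {1..n} {1..n}"
    by (simp add: bij_betw_def endo_inj_surj)
  show "greedy_perm n x i = i" if "i \<notin> {1..n}" for i
    using that by (metis greedy_perm.simps)
qed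

end

(* With L = sqrt (2 ln n), every entry satisfies L x <= exp (L x) / c + ln c - 1 for all c > 0; summing
   the exponentials over a row and taking c = n exp (L^2 / 2) bounds the expectation of each greedy
   entry by L.
   Conversely, the n + 1 - i columns remaining in row i are independent of that row, so the greedy
   entry falls below t with probability at most (1 - p)^(n + 1 - i), where p = phi (t + 1) <= P(X >= t)
   for t >= 0, and its negative part has expectation at most E|X| <= 1. Summing the geometric series
   gives E S >= t (n - 1 / p) - n, and t = L - 2 makes n p tend to infinity. *)
theory Submission
  imports Defs "HOL-Real_Asymp.Real_Asymp"
begin

section \<open>Moments and a tail bound for one standard Gaussian variable\<close>

context prob_space
begin

text \<open>Completing the square: tilting the standard density by \<open>exp (l * x)\<close> gives
  \<open>exp (l\<^sup>2 / 2)\<close> times the normal density with mean \<open>l\<close>.\<close>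

lemma expectation_exp_std_normal:
  assumes "distributed M lborel Y std_normal_density"
  shows "integrable M (\<lambda>\<omega>. exp (l * Y \<omega>))" "expectation (\<lambda>\<omega>. exp (l * Y \<omega>)) = exp (l\<^sup>2 / 2)"
proof -
  have eq: "std_normal_density x * exp (l * x) = exp (l\<^sup>2 / 2) * normal_density l 1 x" for x
    by (simp add: normal_density_def exp_add[symmetric] power2_eq_square field_simps)
  show "integrable M (\<lambda>\<omega>. exp (l * Y \<omega>))"
    by (subst distributed_integrable[OF assms, symmetric]) (auto simp: eq)
  show "expectation (\<lambda>\<omega>. exp (l * Y \<omega>)) = exp (l\<^sup>2 / 2)"
    by (subst distributed_integral[OF assms, symmetric]) (auto simp: eq)
qed

text \<open>Serves twice: to dominate the greedy entries, and to charge at most one unit per row for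
  their negative part.\<close>

lemma expectation_abs_std_normal:
  assumes "distributed M lborel Y std_normal_density"
  shows "integrable M (\<lambda>\<omega>. \<bar>Y \<omega>\<bar>)" "expectation (\<lambda>\<omega>. \<bar>Y \<omega>\<bar>) \<le> 1"
proof -
  show "integrable M (\<lambda>\<omega>. \<bar>Y \<omega>\<bar>)"
    using integrable_std_normal_moment_abs[of 1]
    by (subst distributed_integrable[OF assms, symmetric]) auto
  have "expectation (\<lambda>\<omega>. \<bar>Y \<omega>\<bar>) = sqrt (2 / pi)"
    using integral_std_normal_moment_abs_odd[of 0]
    by (subst distributed_integral[OF assms, symmetric]) auto
  also have "\<dots> \<le> 1"
    using pi_ge_two by simp
  finally show "expectation (\<lambda>\<omega>. \<bar>Y \<omega>\<bar>) \<le> 1" .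
qed

text \<open>The density decreases on the half-line from 0, so the unit interval
  \<open>{t..t+1}\<close> carries at least the mass given by the density at its right
  endpoint.\<close>

lemma prob_std_normal_less_le:
  assumes D: "distributed M lborel Y std_normal_density" and "0 \<le> t"
  shows "prob {\<omega> \<in> space M. Y \<omega> < t} \<le> 1 - std_normal_density (t + 1)"
proof -
  have Y[measurable]: "Y \<in> borel_measurable M"
    using distributed_measurable[OF D] by simp
  have "std_normal_density (t + 1) = (\<integral>x. std_normal_density (t + 1) * indicator {t..t+1} x \<partial>lborel)"
    by simp
  also have "\<dots> \<le> (\<integral>x. std_normal_density x * indicator {t..} x \<partial>lborel)"
  proof (rule integral_mono)
    show "integrable lborel (\<lambda>x. std_normal_density (t + 1) * indicator {t..t+1} x)"
      by simp
    show "integrable lborel (\<lambda>x. std_normal_density x * indicator {t..} x)"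
      using integrable_std_normal_moment[of 0] by (intro integrable_real_mult_indicator) auto
    fix x
    have "std_normal_density (t + 1) \<le> std_normal_density x" if "t \<le> x" "x \<le> t + 1"
      using that \<open>0 \<le> t\<close> by (auto simp: std_normal_density_def divide_right_mono power_mono)
    then show "std_normal_density (t + 1) * indicator {t..t+1} x \<le> std_normal_density x * indicator {t..} x"
      by (auto simp: indicator_def)
  qed
  also have "\<dots> = expectation (\<lambda>\<omega>. indicator {t..} (Y \<omega>))"
    by (subst distributed_integral[OF D]) auto
  also have "\<dots> = expectation (indicator {\<omega> \<in> space M. \<not> Y \<omega> < t})"
    by (intro Bochner_Integration.integral_cong) (auto simp: indicator_def)
  also have "\<dots> = prob {\<omega> \<in> space M. \<not> Y \<omega> < t}"
    by (auto intro!: arg_cong[where f=prob])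
  also have "\<dots> = 1 - prob {\<omega> \<in> space M. Y \<omega> < t}"
    by (rule prob_neg) auto
  finally show ?thesis by simp
qed

end

section \<open>Locality and measurability of the greedy choice\<close>

lemma arg_max_on_cong:
  assumes "\<And>a. a \<in> A \<Longrightarrow> f a = g a"
  shows "arg_max_on f A = arg_max_on g A"
proof -
  have "is_arg_max f (\<lambda>a. a \<in> A) = is_arg_max g (\<lambda>a. a \<in> A)"
    using assms by (auto simp: is_arg_max_def fun_eq_iff)
  then show ?thesis
    by (simp add: arg_max_on_def arg_max_def)
qed

text \<open>The recursion reads only rows up to \<open>i\<close>; this locality later makes a row
  independent of the columns left for it.\<close>

lemma greedy_perm_cong:
  assumes "\<And>k j. k \<in> {1..i} \<Longrightarrow> j \<in> {1..n} \<Longrightarrow> x k j = y k j"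
  shows "greedy_perm n x i = greedy_perm n y i"
  using assms
proof (induction i rule: less_induct)
  case (less i)
  have "greedy_perm n x ` {1..<i} = greedy_perm n y ` {1..<i}"
    by (intro image_cong refl less.IH less.prems) auto
  then show ?case
    using less.prems
    by (subst (1 2) greedy_perm.simps) (auto intro!: arg_max_on_cong)
qed

text \<open>Ties are resolved by Hilbert choice. Its value depends only on the set of maximizers,
  which ranges over the finite \<open>Pow A\<close>, and every map out of a finite discrete space is
  measurable.\<close>

lemma measurable_arg_max_on:
  fixes f :: "nat \<Rightarrow> 'b \<Rightarrow> real"
  assumes f: "\<And>j. j \<in> A \<Longrightarrow> f j \<in> borel_measurable N" and A: "finite A"
  shows "(\<lambda>\<omega>. arg_max_on (\<lambda>j. f j \<omega>) A) \<in> measurable N (count_space UNIV)"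
proof -
  define h where "h \<omega> = {j \<in> A. \<forall>k\<in>A. f k \<omega> \<le> f j \<omega>}" for \<omega>
  have "(\<lambda>\<omega>. SOME j. j \<in> h \<omega>) \<in> measurable N (count_space UNIV)"
  proof (rule measurable_compose[of h _ "count_space (Pow A)"])
    show "h \<in> measurable N (count_space (Pow A))"
      unfolding measurable_count_space_eq2[OF finite_Pow_iff[THEN iffD2, OF A]]
    proof (intro conjI ballI)
      fix S assume "S \<in> Pow A"
      then have "h -` {S} \<inter> space N
          = {\<omega> \<in> space N. \<forall>j\<in>A. (\<forall>k\<in>A. f k \<omega> \<le> f j \<omega>) \<longleftrightarrow> j \<in> S}"
        unfolding h_def by blast
      also have "\<dots> \<in> sets N"
        using A f by (intro sets.sets_Collect_finite_All' sets.sets_Collect_finite_All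
            predE pred_intros_finite pred_intros_logic) auto
      finally show "h -` {S} \<inter> space N \<in> sets N" .
    qed (auto simp: h_def)
  qed simp
  moreover have "arg_max_on (\<lambda>j. f j \<omega>) A = (SOME j. j \<in> h \<omega>)" for \<omega>
    by (auto simp: arg_max_on_def arg_max_def is_arg_max_def h_def not_less intro!: arg_cong[where f=Eps])
  ultimately show ?thesis by simp
qed

text \<open>Named separately because this set, unlike the choice made in row \<open>i\<close>,
  depends only on the rows strictly above; the lower bound splits the probability space by its
  value.\<close>

definition remaining_columns :: "nat \<Rightarrow> (nat \<Rightarrow> nat \<Rightarrow> real) \<Rightarrow> nat \<Rightarrow> nat set" where
  "remaining_columns n x i = {1..n} - greedy_perm n x ` {1..<i}"

lemma remaining_columns_subset: "remaining_columns n x i \<subseteq> {1..n}"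
  by (auto simp: remaining_columns_def)

lemma card_remaining_columns:
  assumes "i \<in> {1..n}"
  shows "card (remaining_columns n x i) = n + 1 - i"
proof -
  have "inj_on (greedy_perm n x) {1..<i}"
    using permutes_inj[OF greedy_perm_permutes] by (rule inj_on_subset) simp
  then have "card (greedy_perm n x ` {1..<i}) = i - 1"
    by (simp add: card_image)
  moreover have "greedy_perm n x ` {1..<i} \<subseteq> {1..n}"
    using permutes_image[OF greedy_perm_permutes[of n x]] assms by (auto 0 3)
  ultimately show ?thesis
    using assms by (simp add: remaining_columns_def card_Diff_subset finite_subset)
qed

lemma remaining_columns_cong:
  assumes "\<And>k j. k \<in> {1..<i} \<Longrightarrow> j \<in> {1..n} \<Longrightarrow> x k j = y k j"
  shows "remaining_columns n x i = remaining_columns n y i"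
  unfolding remaining_columns_def
  by (intro arg_cong2[where f="(-)"] image_cong refl greedy_perm_cong assms) auto

lemma greedy_perm_eq_arg_max_on:
  "i \<in> {1..n} \<Longrightarrow> greedy_perm n x i = arg_max_on (x i) (remaining_columns n x i)"
  by (subst greedy_perm.simps) (simp add: remaining_columns_def)

lemma greedy_perm_ge:
  assumes "i \<in> {1..n}" "j \<in> remaining_columns n x i"
  shows "x i j \<le> x i (greedy_perm n x i)"
  unfolding greedy_perm_eq_arg_max_on[OF assms(1)]
  by (rule arg_max_on_finite(2)) (use assms in \<open>auto simp: remaining_columns_def\<close>)

text \<open>Equality of subsets of \<open>{1..n}\<close> is a finite Boolean combination of the
  events that row \<open>k\<close> takes column \<open>j\<close>. Measurability is asked only for
  \<open>k < i\<close>, so the induction for \<open>greedy_perm\<close> can call this.\<close>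

lemma measurable_remaining_columns:
  assumes "\<And>k. k \<in> {1..<i} \<Longrightarrow> (\<lambda>\<omega>. greedy_perm n (x \<omega>) k) \<in> measurable N (count_space UNIV)"
  shows "(\<lambda>\<omega>. remaining_columns n (x \<omega>) i) \<in> measurable N (count_space (Pow {1..n}))"
  unfolding measurable_count_space_eq2[OF finite_Pow_iff[THEN iffD2, OF finite_atLeastAtMost]]
proof (intro conjI ballI)
  fix S assume S: "S \<in> Pow {1..n}"
  have "remaining_columns n y i = S
      \<longleftrightarrow> (\<forall>j\<in>{1..n}. (\<exists>k\<in>{1..<i}. greedy_perm n y k = j) \<longleftrightarrow> j \<notin> S)" for y
  proof -
    have "remaining_columns n y i = S \<longleftrightarrow> (\<forall>j\<in>{1..n}. j \<in> remaining_columns n y i \<longleftrightarrow> j \<in> S)"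
      using S remaining_columns_subset[of n y i] unfolding set_eq_iff Pow_iff by blast
    also have "\<dots> \<longleftrightarrow> (\<forall>j\<in>{1..n}. (\<exists>k\<in>{1..<i}. greedy_perm n y k = j) \<longleftrightarrow> j \<notin> S)"
      by (intro ball_cong refl) (auto simp: remaining_columns_def)
    finally show ?thesis .
  qed
  then have "(\<lambda>\<omega>. remaining_columns n (x \<omega>) i) -` {S} \<inter> space N
      = {\<omega> \<in> space N. \<forall>j\<in>{1..n}. (\<exists>k\<in>{1..<i}. greedy_perm n (x \<omega>) k = j) \<longleftrightarrow> j \<notin> S}"
    by (simp only: vimage_def Int_def mem_Collect_eq singleton_iff conj_commute)
  also have "\<dots> \<in> sets N"
    using assms by (intro predE pred_intros_finite pred_intros_logic pred_eq_const1) auto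
  finally show "(\<lambda>\<omega>. remaining_columns n (x \<omega>) i) -` {S} \<inter> space N \<in> sets N" .
qed (auto simp: remaining_columns_def)

text \<open>Strong induction on the row: for each of the finitely many values of the remaining set
  the maximizer is measurable, and these pieces are glued. The source \<open>N\<close> is arbitrary,
  to serve both the probability space and a product of rows.\<close>

lemma measurable_greedy_perm:
  assumes "\<And>k j. k \<in> {1..i} \<Longrightarrow> j \<in> {1..n} \<Longrightarrow> (\<lambda>\<omega>. x \<omega> k j) \<in> borel_measurable N"
  shows "(\<lambda>\<omega>. greedy_perm n (x \<omega>) i) \<in> measurable N (count_space UNIV)"
  using assms
proof (induction i rule: less_induct)
  case (less i)
  show ?case
  proof (cases "i \<in> {1..n}")
    case True
    have R: "(\<lambda>\<omega>. remaining_columns n (x \<omega>) i) \<in> measurable N (count_space (Pow {1..n}))"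
      using less by (intro measurable_remaining_columns) auto
    have "(\<lambda>\<omega>. arg_max_on (x \<omega> i) (remaining_columns n (x \<omega>) i)) \<in> measurable N (count_space UNIV)"
    proof (rule measurable_compose_countable'[OF _ R])
      fix A assume "A \<in> Pow {1..n}"
      then show "(\<lambda>\<omega>. arg_max_on (x \<omega> i) A) \<in> measurable N (count_space UNIV)"
        using True less.prems by (intro measurable_arg_max_on) (auto intro: finite_subset)
    qed (auto intro: countable_finite)
    then show ?thesis
      using True by (simp add: greedy_perm_eq_arg_max_on)
  next
    case False
    then have "greedy_perm n (x \<omega>) i = i" for \<omega>
      by (subst greedy_perm.simps) auto
    then show ?thesis by simp
  qed
qed

text \<open>With \<open>n = exp (L\<^sup>2 / 2)\<close> this is the lower bound for the expected sum
  at \<open>t = L - 2\<close>, divided by \<open>n * L\<close>.\<close>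

lemma tendsto_lower_bound_ratio:
  "((\<lambda>L::real. ((L - 2) * (1 - sqrt (2 * pi) * exp (1 / 2 - L)) - 1) / L) \<longlongrightarrow> 1) at_top"
  by real_asymp

section \<open>A Gaussian matrix of fixed size: measurability and integrability of the greedy
  entries\<close>

locale gaussian_matrix = prob_space +
  fixes n :: nat and X :: "nat \<Rightarrow> nat \<Rightarrow> 'a \<Rightarrow> real"
  assumes indep: "indep_vars (\<lambda>_. borel) (\<lambda>(i, j). X i j) ({1..n} \<times> {1..n})"
    and std_normal: "\<And>i j. i \<in> {1..n} \<Longrightarrow> j \<in> {1..n} \<Longrightarrow> distributed M lborel (X i j) std_normal_density"
begin

abbreviation greedy :: "'a \<Rightarrow> nat \<Rightarrow> nat" where
  "greedy \<omega> \<equiv> greedy_perm n (\<lambda>i j. X i j \<omega>)"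

abbreviation remaining :: "'a \<Rightarrow> nat \<Rightarrow> nat set" where
  "remaining \<omega> \<equiv> remaining_columns n (\<lambda>i j. X i j \<omega>)"

lemma measurable_X: "i \<in> {1..n} \<Longrightarrow> j \<in> {1..n} \<Longrightarrow> X i j \<in> borel_measurable M"
  using distributed_measurable[OF std_normal] by simp

lemma greedy_in: "i \<in> {1..n} \<Longrightarrow> greedy \<omega> i \<in> {1..n}"
  using greedy_perm_in by blast

lemma measurable_greedy_value:
  assumes i: "i \<in> {1..n}"
  shows "(\<lambda>\<omega>. X i (greedy \<omega> i) \<omega>) \<in> borel_measurable M"
proof -
  have "(\<lambda>\<omega>. greedy \<omega> i) \<in> measurable M (count_space UNIV)"
    using i by (intro measurable_greedy_perm measurable_X) auto
  \<comment> \<open>The random column index is removed by summing over all columns and keeping the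
    chosen one.\<close>
  then have "(\<lambda>\<omega>. \<Sum>j\<in>{1..n}. if greedy \<omega> i = j then X i j \<omega> else 0) \<in> borel_measurable M"
    using i by (intro borel_measurable_sum measurable_If measurable_X predE pred_eq_const1) auto
  moreover have "(\<Sum>j\<in>{1..n}. if greedy \<omega> i = j then X i j \<omega> else 0) = X i (greedy \<omega> i) \<omega>" for \<omega>
    using greedy_in[OF i] by (subst sum.delta') auto
  ultimately show ?thesis by simp
qed

lemma integrable_greedy_value:
  assumes i: "i \<in> {1..n}"
  shows "integrable M (\<lambda>\<omega>. X i (greedy \<omega> i) \<omega>)"
proof (rule Bochner_Integration.integrable_bound)
  show "integrable M (\<lambda>\<omega>. \<Sum>j\<in>{1..n}. \<bar>X i j \<omega>\<bar>)"
    using i by (intro Bochner_Integration.integrable_sum expectation_abs_std_normal std_normal) auto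
  have "\<bar>X i (greedy \<omega> i) \<omega>\<bar> \<le> (\<Sum>j\<in>{1..n}. \<bar>X i j \<omega>\<bar>)" for \<omega>
    using greedy_in[OF i] by (intro member_le_sum) auto
  then show "AE \<omega> in M. norm (X i (greedy \<omega> i) \<omega>) \<le> norm (\<Sum>j\<in>{1..n}. \<bar>X i j \<omega>\<bar>)"
    by (simp add: abs_of_nonneg sum_nonneg)
qed (rule measurable_greedy_value[OF i])

text \<open>A maximal inequality by exponential moments: the exponential of the greedy entry is at
  most the sum of the exponentials over its row. The parameter \<open>L\<close> stays free for
  optimization.\<close>

lemma expectation_greedy_value_le:
  assumes i: "i \<in> {1..n}" and L: "L > 0"
  shows "expectation (\<lambda>\<omega>. X i (greedy \<omega> i) \<omega>) \<le> (ln (real n) + L\<^sup>2 / 2) / L"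
proof -
  have n: "real n > 0" using i by auto
  \<comment> \<open>\<open>c\<close> is the expectation of the row sum of exponentials, so the
    quotient by \<open>c\<close> has mean 1 and cancels the \<open>- 1\<close>.\<close>
  define c where "c = real n * exp (L\<^sup>2 / 2)"
  have c: "c > 0" using n by (simp add: c_def)
  have int: "integrable M (\<lambda>\<omega>. exp (L * X i j \<omega>))" 
    "expectation (\<lambda>\<omega>. exp (L * X i j \<omega>)) = exp (L\<^sup>2 / 2)" if "j \<in> {1..n}" for j
    using expectation_exp_std_normal[OF std_normal[OF i that]] by auto
  have int_sum: "integrable M (\<lambda>\<omega>. \<Sum>j\<in>{1..n}. exp (L * X i j \<omega>))"
    by (intro Bochner_Integration.integrable_sum int(1))
  have exp_sum: "expectation (\<lambda>\<omega>. \<Sum>j\<in>{1..n}. exp (L * X i j \<omega>)) = (\<Sum>j\<in>{1..n}. exp (L\<^sup>2 / 2))"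
    using int by (subst Bochner_Integration.integral_sum) (auto simp del: sum_constant)
  have le: "X i (greedy \<omega> i) \<omega> \<le> ((\<Sum>j\<in>{1..n}. exp (L * X i j \<omega>)) / c + ln c - 1) / L" for \<omega>
  proof -
    let ?y = "exp (L * X i (greedy \<omega> i) \<omega>)"
    \<comment> \<open>The tangent of \<open>ln\<close> at 1 takes the place of Jensen's inequality,
      pointwise in \<omega>.\<close>
    have "ln (?y / c) \<le> ?y / c - 1"
      using c by (intro ln_le_minus_one) simp
    then have "L * X i (greedy \<omega> i) \<omega> \<le> ?y / c + ln c - 1"
      using c by (simp add: ln_div)
    also have "?y \<le> (\<Sum>j\<in>{1..n}. exp (L * X i j \<omega>))"
      using greedy_in[OF i] by (intro member_le_sum) auto
    finally show ?thesis
      using L c by (simp add: field_simps divide_right_mono)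
  qed
  have "expectation (\<lambda>\<omega>. X i (greedy \<omega> i) \<omega>)
      \<le> expectation (\<lambda>\<omega>. ((\<Sum>j\<in>{1..n}. exp (L * X i j \<omega>)) / c + ln c - 1) / L)"
    using int_sum by (intro integral_mono integrable_greedy_value i le) auto
  also have "\<dots> = ((\<Sum>j\<in>{1..n}. exp (L\<^sup>2 / 2)) / c + ln c - 1) / L"
    using int_sum by (simp add: prob_space exp_sum del: sum_constant One_nat_def)
  also have "\<dots> = (ln (real n) + L\<^sup>2 / 2) / L"
    using n by (simp add: c_def ln_mult)
  finally show ?thesis .
qed

section \<open>Independence of a row from the columns left for it\<close>

lemma sets_remaining:
  assumes i: "i \<in> {1..n}" and A: "A \<subseteq> {1..n}"
  shows "{\<omega> \<in> space M. remaining \<omega> i = A} \<in> sets M"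
proof -
  have "(\<lambda>\<omega>. remaining \<omega> i) \<in> measurable M (count_space (Pow {1..n}))"
    using i by (intro measurable_remaining_columns measurable_greedy_perm measurable_X) auto
  from measurable_sets[OF this, of "{A}"] A show ?thesis
    by (simp add: vimage_def Int_def conj_commute)
qed

text \<open>
  The columns remaining in row \<open>i\<close> are a function of the rows above \<open>i\<close>, hence independent of row \<open>i\<close>.
\<close>
lemma expectation_remaining_mult:
  fixes g :: "(nat \<Rightarrow> real) \<Rightarrow> real"
  assumes i: "i \<in> {1..n}" and A: "A \<subseteq> {1..n}"
    and g: "(\<lambda>x. g (\<lambda>j. x (i, j))) \<in> borel_measurable (PiM ({i} \<times> {1..n}) (\<lambda>_. borel))"
    and g_cong: "\<And>x y. (\<And>j. j \<in> {1..n} \<Longrightarrow> x j = y j) \<Longrightarrow> g x = g y"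
    and int: "integrable M (\<lambda>\<omega>. g (\<lambda>j. X i j \<omega>))"
  shows "integrable M (\<lambda>\<omega>. of_bool (remaining \<omega> i = A) * g (\<lambda>j. X i j \<omega>))"
    and "expectation (\<lambda>\<omega>. of_bool (remaining \<omega> i = A) * g (\<lambda>j. X i j \<omega>))
      = prob {\<omega> \<in> space M. remaining \<omega> i = A} * expectation (\<lambda>\<omega>. g (\<lambda>j. X i j \<omega>))"
proof -
  let ?P = "{1..<i} \<times> {1..n}" and ?Q = "{i} \<times> {1..n}"
  let ?f = "\<lambda>x. of_bool (remaining_columns n (\<lambda>k j. x (k, j)) i = A) :: real"
  \<comment> \<open>The index blocks \<open>?P\<close> and \<open>?Q\<close> are disjoint, so the
    restrictions of the family to them are independent.\<close>
  have iv: "indep_var (PiM ?P (\<lambda>_. borel)) (\<lambda>\<omega>. restrict (\<lambda>p. (case p of (k, j) \<Rightarrow> X k j) \<omega>) ?P)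
      (PiM ?Q (\<lambda>_. borel)) (\<lambda>\<omega>. restrict (\<lambda>p. (case p of (k, j) \<Rightarrow> X k j) \<omega>) ?Q)"
    using i by (intro indep_var_restrict[OF indep]) auto
  have R: "(\<lambda>x. remaining_columns n (\<lambda>k j. x (k, j)) i)
      \<in> measurable (PiM ?P (\<lambda>_. borel)) (count_space (Pow {1..n}))"
    by (intro measurable_remaining_columns measurable_greedy_perm measurable_component_singleton) auto
  have f: "?f \<in> borel_measurable (PiM ?P (\<lambda>_. borel))"
    by (rule measurable_compose[OF R]) simp
  have "indep_var borel (?f \<circ> (\<lambda>\<omega>. restrict (\<lambda>p. (case p of (k, j) \<Rightarrow> X k j) \<omega>) ?P))
     borel ((\<lambda>x. g (\<lambda>j. x (i, j))) \<circ> (\<lambda>\<omega>. restrict (\<lambda>p. (case p of (k, j) \<Rightarrow> X k j) \<omega>) ?Q))"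
    by (rule indep_var_compose[OF iv f g])
  moreover have "?f \<circ> (\<lambda>\<omega>. restrict (\<lambda>p. (case p of (k, j) \<Rightarrow> X k j) \<omega>) ?P) = (\<lambda>\<omega>. of_bool (remaining \<omega> i = A))"
    by (auto simp: fun_eq_iff intro!: arg_cong[where f=of_bool] arg_cong[where f="\<lambda>B. B = A"] remaining_columns_cong)
  moreover have "(\<lambda>x. g (\<lambda>j. x (i, j))) \<circ> (\<lambda>\<omega>. restrict (\<lambda>p. (case p of (k, j) \<Rightarrow> X k j) \<omega>) ?Q)
      = (\<lambda>\<omega>. g (\<lambda>j. X i j \<omega>))"
    by (auto simp: fun_eq_iff intro!: g_cong)
  ultimately have ind: "indep_var borel (\<lambda>\<omega>. of_bool (remaining \<omega> i = A) :: real) borel (\<lambda>\<omega>. g (\<lambda>j. X i j \<omega>))"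
    by simp
  have eq: "of_bool (remaining \<omega> i = A) = indicat_real {\<omega> \<in> space M. remaining \<omega> i = A} \<omega>"
    if "\<omega> \<in> space M" for \<omega>
    using that by (auto simp: indicator_def)
  have intR: "integrable M (\<lambda>\<omega>. of_bool (remaining \<omega> i = A) :: real)"
    using sets_remaining[OF i A] by (subst Bochner_Integration.integrable_cong[OF refl eq]) (auto simp: less_top[symmetric])
  have "expectation (\<lambda>\<omega>. of_bool (remaining \<omega> i = A)) = prob {\<omega> \<in> space M. remaining \<omega> i = A}"
    by (subst Bochner_Integration.integral_cong[OF refl eq]) (auto intro!: arg_cong[where f=prob])
  then show "expectation (\<lambda>\<omega>. of_bool (remaining \<omega> i = A) * g (\<lambda>j. X i j \<omega>))
      = prob {\<omega> \<in> space M. remaining \<omega> i = A} * expectation (\<lambda>\<omega>. g (\<lambda>j. X i j \<omega>))"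
    using indep_var_lebesgue_integral[OF ind intR int] by simp
  show "integrable M (\<lambda>\<omega>. of_bool (remaining \<omega> i = A) * g (\<lambda>j. X i j \<omega>))"
    using indep_var_integrable[OF ind intR int] .
qed

section \<open>Lower bound for the expectation of one greedy entry\<close>

lemma sum_prob_remaining:
  assumes i: "i \<in> {1..n}"
  shows "(\<Sum>A\<in>Pow {1..n}. prob {\<omega> \<in> space M. remaining \<omega> i = A}) = 1"
proof -
  have "(\<Sum>A\<in>Pow {1..n}. prob {\<omega> \<in> space M. remaining \<omega> i = A})
     = prob (\<Union>A\<in>Pow {1..n}. {\<omega> \<in> space M. remaining \<omega> i = A})"
    using sets_remaining[OF i] by (intro finite_measure_finite_Union[symmetric]) (auto simp: disjoint_family_on_def)
  also have "(\<Union>A\<in>Pow {1..n}. {\<omega> \<in> space M. remaining \<omega> i = A}) = space M"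
    using remaining_columns_subset by auto
  finally show ?thesis by (simp add: prob_space)
qed

text \<open>For a fixed \<open>A\<close> the entries of the row are independent, so the one-entry
  tail bound multiplies over \<open>A\<close>.\<close>

lemma prob_row_less_le:
  assumes i: "i \<in> {1..n}" and A: "A \<subseteq> {1..n}" "A \<noteq> {}" and t: "0 \<le> t"
  shows "prob {\<omega> \<in> space M. \<forall>j\<in>A. X i j \<omega> < t} \<le> (1 - std_normal_density (t + 1)) ^ card A"
proof -
  have fin: "finite A" using A finite_subset by blast
  have "{\<omega> \<in> space M. \<forall>j\<in>A. X i j \<omega> < t} = (\<Inter>p\<in>{i} \<times> A. (case p of (k, j) \<Rightarrow> X k j) -` {..<t} \<inter> space M)"
    using A by auto
  then have "prob {\<omega> \<in> space M. \<forall>j\<in>A. X i j \<omega> < t}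
      = (\<Prod>p\<in>{i} \<times> A. prob ((case p of (k, j) \<Rightarrow> X k j) -` {..<t} \<inter> space M))"
    using i A fin by (simp only:) (intro indep_varsD[OF indep], auto)
  also have "\<dots> \<le> (\<Prod>p\<in>{i} \<times> A. 1 - std_normal_density (t + 1))"
  proof (intro prod_mono conjI)
    fix p assume "p \<in> {i} \<times> A"
    then obtain j where p: "p = (i, j)" "j \<in> {1..n}" using A by auto
    have "X i j -` {..<t} \<inter> space M = {\<omega> \<in> space M. X i j \<omega> < t}" by auto
    then show "prob ((case p of (k, j) \<Rightarrow> X k j) -` {..<t} \<inter> space M) \<le> 1 - std_normal_density (t + 1)"
      using prob_std_normal_less_le[OF std_normal[OF i p(2)] t] p by simp
  qed simp
  finally show ?thesis by (simp add: card_cartesian_product)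
qed

text \<open>The shortfall below \<open>t\<close> is bounded for each fixed set of columns, then
  averaged over the values of the remaining set, which is independent of the row and has
  \<open>n + 1 - i\<close> elements.\<close>

lemma expectation_greedy_value_ge:
  assumes i: "i \<in> {1..n}" and t: "0 \<le> t"
  shows "expectation (\<lambda>\<omega>. X i (greedy \<omega> i) \<omega>) \<ge> t - t * (1 - std_normal_density (t + 1)) ^ (n + 1 - i) - 1"
proof -
  \<comment> \<open>For nonempty \<open>A\<close>, \<open>g A\<close> dominates \<open>t\<close>
    minus the largest entry over \<open>A\<close>: the first term pays \<open>t\<close> when all
    entries lie below it, the second pays for a negative maximum, which is at least the entry at
    \<open>Min A\<close>. The value 0 for empty \<open>A\<close> keeps integrability and
    measurability available on all of \<open>Pow {1..n}\<close>.\<close>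
  define g where "g A x = t * of_bool (\<forall>j\<in>A. x j < t) + (if A = {} then 0 else \<bar>x (Min A)\<bar>)"
    for A :: "nat set" and x :: "nat \<Rightarrow> real"
  define q where "q = t * (1 - std_normal_density (t + 1)) ^ (n + 1 - i) + 1"
  let ?R = "\<lambda>A. {\<omega> \<in> space M. remaining \<omega> i = A}"
  have MinA: "Min A \<in> A" "Min A \<in> {1..n}" if "A \<subseteq> {1..n}" "A \<noteq> {}" for A
    using that Min_in[of A] finite_subset[OF that(1)] by blast+
  have sets: "{\<omega> \<in> space M. \<forall>j\<in>A. X i j \<omega> < t} \<in> sets M" if "A \<subseteq> {1..n}" for A
  proof -
    have "Measurable.pred M (\<lambda>\<omega>. X i j \<omega> < t)" if "j \<in> A" for j
      using measurable_X[OF i, of j] that \<open>A \<subseteq> {1..n}\<close> by (intro borel_measurable_pred_less) auto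
    then show ?thesis
      using finite_subset[OF that] by (intro predE pred_intros_finite) auto
  qed
  have eq: "of_bool (\<forall>j\<in>A. X i j \<omega> < t) = indicat_real {\<omega> \<in> space M. \<forall>j\<in>A. X i j \<omega> < t} \<omega>"
    if "\<omega> \<in> space M" for A \<omega>
    using that by (auto simp: indicator_def)
  have int1: "integrable M (\<lambda>\<omega>. of_bool (\<forall>j\<in>A. X i j \<omega> < t) :: real)" if "A \<subseteq> {1..n}" for A
    using sets[OF that] by (subst Bochner_Integration.integrable_cong[OF refl eq]) (auto simp: less_top[symmetric])
  have exp1: "expectation (\<lambda>\<omega>. of_bool (\<forall>j\<in>A. X i j \<omega> < t)) = prob {\<omega> \<in> space M. \<forall>j\<in>A. X i j \<omega> < t}" for A
    by (subst Bochner_Integration.integral_cong[OF refl eq]) (auto intro!: arg_cong[where f=prob])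
  have int2: "integrable M (\<lambda>\<omega>. if A = {} then 0 else \<bar>X i (Min A) \<omega>\<bar>)" if "A \<subseteq> {1..n}" for A
    using expectation_abs_std_normal(1)[OF std_normal[OF i MinA(2)[OF that]]] by (cases "A = {}") auto
  have int: "integrable M (\<lambda>\<omega>. g A (\<lambda>j. X i j \<omega>))" if "A \<subseteq> {1..n}" for A
    unfolding g_def using int1[OF that] int2[OF that] by (intro Bochner_Integration.integrable_add) auto
  have exp: "expectation (\<lambda>\<omega>. g A (\<lambda>j. X i j \<omega>)) \<le> q" if "A \<subseteq> {1..n}" "card A = n + 1 - i" for A
  proof -
    have ne: "A \<noteq> {}" using that i by auto
    have "expectation (\<lambda>\<omega>. g A (\<lambda>j. X i j \<omega>))
        = t * prob {\<omega> \<in> space M. \<forall>j\<in>A. X i j \<omega> < t} + expectation (\<lambda>\<omega>. \<bar>X i (Min A) \<omega>\<bar>)"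
      unfolding g_def using int1[OF that(1)] int2[OF that(1)] ne
      by (subst Bochner_Integration.integral_add) (auto simp: exp1)
    also have "\<dots> \<le> q"
      unfolding q_def that(2)[symmetric]
      using expectation_abs_std_normal(2)[OF std_normal[OF i MinA(2)[OF that(1) ne]]]
        prob_row_less_le[OF i that(1) ne t] t
      by (intro add_mono mult_left_mono) auto
    finally show ?thesis .
  qed
  have meas: "(\<lambda>x. g A (\<lambda>j. x (i, j))) \<in> borel_measurable (PiM ({i} \<times> {1..n}) (\<lambda>_. borel))"
    if A: "A \<subseteq> {1..n}" for A
  proof -
    have [measurable]: "(\<lambda>x. x (i, j)) \<in> borel_measurable (PiM ({i} \<times> {1..n}) (\<lambda>_. borel :: real measure))"
      if "j \<in> {1..n}" for j
      using that by (intro measurable_component_singleton) auto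
    have "finite A" using A finite_subset by blast
    then have "Measurable.pred (PiM ({i} \<times> {1..n}) (\<lambda>_. borel :: real measure)) (\<lambda>x. \<forall>j\<in>A. x (i, j) < t)"
      using A by (intro pred_intros_finite) auto
    moreover have "(\<lambda>x. if A = {} then 0 else \<bar>x (i, Min A)\<bar>) \<in> borel_measurable (PiM ({i} \<times> {1..n}) (\<lambda>_. borel :: real measure))"
    proof (cases "A = {}")
      case False
      then show ?thesis
        using MinA(2)[OF A] by simp
    qed simp
    ultimately show ?thesis
      unfolding g_def by measurable
  qed
  have cong: "g A x = g A y" if "A \<subseteq> {1..n}" "\<And>j. j \<in> {1..n} \<Longrightarrow> x j = y j" for A x y
  proof -
    have "x j = y j" if "j \<in> A" for j
      using that \<open>A \<subseteq> {1..n}\<close> \<open>\<And>j. j \<in> {1..n} \<Longrightarrow> x j = y j\<close> by auto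
    then show ?thesis
      unfolding g_def using MinA(1)[OF that(1)] by auto
  qed
  note factor = expectation_remaining_mult[OF i _ meas cong int]
  have exp_sum: "expectation (\<lambda>\<omega>. of_bool (remaining \<omega> i = A) * g A (\<lambda>j. X i j \<omega>)) \<le> prob (?R A) * q"
    if A: "A \<in> Pow {1..n}" for A
  proof (cases "card A = n + 1 - i")
    case True
    then show ?thesis
      using A exp[of A] by (subst factor(2)[where A=A]) (auto intro!: mult_left_mono)
  next
    case False
    \<comment> \<open>A set of the wrong size is never left over, so both sides vanish.\<close>
    then have "remaining \<omega> i \<noteq> A" for \<omega>
      using card_remaining_columns[OF i] by metis
    then show ?thesis by simp
  qed
  have le: "t - X i (greedy \<omega> i) \<omega> \<le> (\<Sum>A\<in>Pow {1..n}. of_bool (remaining \<omega> i = A) * g A (\<lambda>j. X i j \<omega>))" for \<omega>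
  proof -
    let ?A = "remaining \<omega> i"
    have sub: "?A \<subseteq> {1..n}" by (rule remaining_columns_subset)
    have "card ?A \<noteq> 0" using i by (subst card_remaining_columns) auto
    then have ne: "?A \<noteq> {}" by auto
    have "t - X i (greedy \<omega> i) \<omega> \<le> g ?A (\<lambda>j. X i j \<omega>)"
    proof (cases "\<forall>j\<in>?A. X i j \<omega> < t")
      case True
      then show ?thesis
        using greedy_perm_ge[OF i MinA(1)[OF sub ne]] ne by (auto simp: g_def)
    next
      case False
      then obtain j where "j \<in> ?A" "t \<le> X i j \<omega>" by auto
      then show ?thesis
        using greedy_perm_ge[OF i \<open>j \<in> ?A\<close>] False by (auto simp: g_def)
    qed
    \<comment> \<open>Exactly one summand survives; this turns the random set into a finite sum of
      products to which \<open>factor\<close> applies.\<close>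
    also have "\<dots> = (\<Sum>A\<in>Pow {1..n}. if ?A = A then g A (\<lambda>j. X i j \<omega>) else 0)"
      using sub by (subst sum.delta') auto
    also have "\<dots> = (\<Sum>A\<in>Pow {1..n}. of_bool (?A = A) * g A (\<lambda>j. X i j \<omega>))"
      by (intro sum.cong) auto
    finally show ?thesis .
  qed
  have "t - expectation (\<lambda>\<omega>. X i (greedy \<omega> i) \<omega>) = expectation (\<lambda>\<omega>. t - X i (greedy \<omega> i) \<omega>)"
    using integrable_greedy_value[OF i] by (simp add: prob_space)
  also have "\<dots> \<le> expectation (\<lambda>\<omega>. \<Sum>A\<in>Pow {1..n}. of_bool (remaining \<omega> i = A) * g A (\<lambda>j. X i j \<omega>))"
    using integrable_greedy_value[OF i]
    by (intro integral_mono le Bochner_Integration.integrable_sum factor(1)) auto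
  also have "\<dots> = (\<Sum>A\<in>Pow {1..n}. expectation (\<lambda>\<omega>. of_bool (remaining \<omega> i = A) * g A (\<lambda>j. X i j \<omega>)))"
    by (intro Bochner_Integration.integral_sum factor(1)) auto
  also have "\<dots> \<le> (\<Sum>A\<in>Pow {1..n}. prob (?R A) * q)"
    by (intro sum_mono exp_sum)
  also have "\<dots> = q"
    by (simp only: sum_distrib_right[symmetric] sum_prob_remaining[OF i] mult_1)
  finally show ?thesis by (simp add: q_def)
qed

section \<open>Summation over the rows\<close>

lemma expectation_assignment_sum_greedy:
  "expectation (\<lambda>\<omega>. assignment_sum n (\<lambda>i j. X i j \<omega>) (greedy \<omega>))
    = (\<Sum>i\<in>{1..n}. expectation (\<lambda>\<omega>. X i (greedy \<omega> i) \<omega>))"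
  unfolding assignment_sum_def
  by (intro Bochner_Integration.integral_sum integrable_greedy_value)

text \<open>\<open>L = sqrt (2 * ln n)\<close> minimizes \<open>(ln n + L\<^sup>2 / 2) / L\<close>,
  whose value there is \<open>L\<close> itself; \<open>n \<ge> 2\<close> makes it positive.\<close>

lemma expectation_assignment_sum_greedy_le:
  assumes "n \<ge> 2"
  shows "expectation (\<lambda>\<omega>. assignment_sum n (\<lambda>i j. X i j \<omega>) (greedy \<omega>)) \<le> n * sqrt (2 * ln n)"
proof -
  let ?L = "sqrt (2 * ln (real n))"
  have L: "?L > 0" using assms by simp
  have "expectation (\<lambda>\<omega>. X i (greedy \<omega> i) \<omega>) \<le> ?L" if "i \<in> {1..n}" for i
    using expectation_greedy_value_le[OF that L] assms by (simp add: real_div_sqrt)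
  then have "(\<Sum>i\<in>{1..n}. expectation (\<lambda>\<omega>. X i (greedy \<omega> i) \<omega>)) \<le> (\<Sum>i\<in>{1..n}. ?L)"
    by (intro sum_mono)
  then show ?thesis
    by (simp add: expectation_assignment_sum_greedy)
qed

text \<open>The miss probabilities are dominated by a geometric series with sum
  \<open>1 / p\<close>, where \<open>p\<close> is the density at \<open>t + 1\<close>, so misses
  cost at most \<open>t / p\<close> in total; the subtracted \<open>n\<close> collects one unit per
  row.\<close>

lemma expectation_assignment_sum_greedy_ge:
  assumes "t \<ge> 0"
  shows "t * (n - 1 / std_normal_density (t + 1)) - n
    \<le> expectation (\<lambda>\<omega>. assignment_sum n (\<lambda>i j. X i j \<omega>) (greedy \<omega>))"
proof -
  define r where "r = 1 - std_normal_density (t + 1)"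
  have p: "1 - r > 0" by (simp add: r_def normal_density_pos)
  \<comment> \<open>Since \<open>2 * pi\<close> exceeds 1, the density is at most 1, and the ratio
    \<open>r\<close> is nonnegative.\<close>
  have "std_normal_density (t + 1) \<le> 1 * 1"
    unfolding std_normal_density_def using pi_ge_two
    by (intro mult_mono) (auto simp: divide_le_eq real_le_rsqrt)
  then have r: "0 \<le> r" by (simp add: r_def)
  \<comment> \<open>Reading the rows backwards, the numbers of columns left give the exponents 1 to
    \<open>n\<close>.\<close>
  have "(\<Sum>i\<in>{1..n}. r ^ (n + 1 - i)) = (\<Sum>i<n. r ^ Suc i)"
    by (rule sum.reindex_bij_witness[of _ "\<lambda>i. n - i" "\<lambda>i. n - i"]) (auto simp: Suc_diff_le)
  also have "\<dots> \<le> (\<Sum>i<n. r ^ i)"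
    using r p by (intro sum_mono) (simp add: mult_left_le_one_le)
  also have "\<dots> = (1 - r ^ n) / (1 - r)"
    using p by (simp add: sum_gp_strict)
  also have "\<dots> \<le> 1 / (1 - r)"
    using r p by (intro divide_right_mono) auto
  finally have geo: "(\<Sum>i\<in>{1..n}. r ^ (n + 1 - i)) \<le> 1 / (1 - r)" .
  have "t * (n - 1 / (1 - r)) - n \<le> t * n - t * (\<Sum>i\<in>{1..n}. r ^ (n + 1 - i)) - n"
    using mult_left_mono[OF geo assms] by (simp add: algebra_simps)
  also have "\<dots> = (\<Sum>i\<in>{1..n}. t - t * r ^ (n + 1 - i) - 1)"
    by (simp add: sum_subtractf sum_distrib_left)
  also have "\<dots> \<le> (\<Sum>i\<in>{1..n}. expectation (\<lambda>\<omega>. X i (greedy \<omega> i) \<omega>))"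
    unfolding r_def by (intro sum_mono expectation_greedy_value_ge assms)
  finally show ?thesis
    by (simp add: r_def expectation_assignment_sum_greedy)
qed

end

section \<open>Passage to the limit, squeezing the normalized expectation\<close>

theorem mainTheorem2:
  fixes M :: "nat \<Rightarrow> 'a measure"
    and X :: "nat \<Rightarrow> nat \<Rightarrow> nat \<Rightarrow> 'a \<Rightarrow> real"
  assumes "\<And>n. n \<ge> 1 \<Longrightarrow> prob_space (M n)"
    and "\<And>n. n \<ge> 1 \<Longrightarrow>
          prob_space.indep_vars (M n) (\<lambda>_. borel) (\<lambda>(i, j). X n i j) ({1..n} \<times> {1..n})"
    and "\<And>n i j. n \<ge> 1 \<Longrightarrow> i \<in> {1..n} \<Longrightarrow> j \<in> {1..n} \<Longrightarrow>
          distributed (M n) lborel (X n i j) std_normal_density"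
  shows "(\<lambda>n. (\<integral>\<omega>. assignment_sum n (\<lambda>i j. X n i j \<omega>)
                        (greedy_perm n (\<lambda>i j. X n i j \<omega>)) \<partial>M n)
              / (real n * sqrt (2 * ln (real n)))) \<longlonglongrightarrow> 1"
    (is "(\<lambda>n. ?E n / _) \<longlonglongrightarrow> 1")
proof (rule tendsto_sandwich)
  let ?L = "\<lambda>n. sqrt (2 * ln (real n))"
  let ?h = "\<lambda>L::real. ((L - 2) * (1 - sqrt (2 * pi) * exp (1 / 2 - L)) - 1) / L"
  have gm: "gaussian_matrix (M n) n (X n)" if "n \<ge> 1" for n
    using assms that by (intro gaussian_matrix.intro gaussian_matrix_axioms.intro)
  have Lt: "filterlim ?L at_top sequentially"
    by real_asymp
  show "(\<lambda>n. ?h (?L n)) \<longlonglongrightarrow> 1"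
    by (rule filterlim_compose[OF tendsto_lower_bound_ratio Lt])
  show "(\<lambda>n. 1 :: real) \<longlonglongrightarrow> 1"
    by simp
  show "\<forall>\<^sub>F n in sequentially. ?E n / (real n * ?L n) \<le> 1"
    using eventually_ge_at_top[of 2]
  proof eventually_elim
    case (elim n)
    then show ?case
      using gaussian_matrix.expectation_assignment_sum_greedy_le[OF gm, of n] by (simp add: divide_le_eq)
  qed
  \<comment> \<open>This makes the threshold \<open>t = L - 2\<close> nonnegative, as the lower
    bound requires.\<close>
  have "\<forall>\<^sub>F n in sequentially. ?L n \<ge> 2"
    using Lt by (simp add: filterlim_at_top)
  then show "\<forall>\<^sub>F n in sequentially. ?h (?L n) \<le> ?E n / (real n * ?L n)"
    using eventually_ge_at_top[of 2]
  proof eventually_elim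
    case (elim n)
    define L where "L = ?L n"
    have L: "L \<ge> 2" using elim by (simp add: L_def)
    have "L\<^sup>2 = 2 * ln n" using elim by (simp add: L_def)
    then have n: "real n = exp (L\<^sup>2 / 2)" using elim by simp
    \<comment> \<open>Here \<open>L - 1\<close> is \<open>t + 1\<close>. Expanding the square leaves
      a factor \<open>exp (1 / 2 - L)\<close> beside \<open>n\<close>, so \<open>1 / p\<close> is of
      lower order than \<open>n\<close>, while \<open>t / L\<close> still tends to 1.\<close>
    have "1 / std_normal_density (L - 1) = sqrt (2 * pi) * exp ((L - 1)\<^sup>2 / 2)"
      by (simp add: std_normal_density_def exp_minus divide_simps)
    also have "(L - 1)\<^sup>2 / 2 = L\<^sup>2 / 2 + (1 / 2 - L)"
      by (simp add: power2_eq_square field_simps)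
    finally have d: "1 / std_normal_density (L - 1) = n * (sqrt (2 * pi) * exp (1 / 2 - L))"
      by (simp only: exp_add n) simp
    have "?h L = ((L - 2) * (n - n * (sqrt (2 * pi) * exp (1 / 2 - L))) - n) / (n * L)"
      using L elim by (simp add: field_simps)
    also have "\<dots> \<le> ?E n / (n * L)"
      using gaussian_matrix.expectation_assignment_sum_greedy_ge[OF gm, of n "L - 2"] L elim
      by (intro divide_right_mono) (auto simp: d)
    finally show ?case by (simp add: L_def)
  qed
qed

end
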